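(* Let $A\in\mathbb{R}^{n\times n}$, $C\in\mathbb{R}^{n_y\times n}$ with $(A,C)$ observable, $L,L_c,N_c\in\mathbb{R}^{n\times n_y}$ with $L=L_c$, $\theta=\theta^T\in\mathbb{R}^{n_y\times n_y}$ with $\theta\ge 0$, $\rho>0$, and $P=P^T\in\mathbb{R}^{n\times n}$ positive definite. Suppose that (i) there is no $v\in\mathbb{R}^n$, $v\neq 0$, with $(A-L_cC)v+(v^TC^T\theta Cv)\,N_cCv=0$; (ii) $(A-L_cC)^TP+P(A-L_cC)=-Q$ with $Q=\rho I$ (in particular this matrix is negative definite); (iii) $PN_cC+C^TN_c^TP<0$. Let $e_l$ be a solution of the linear observer error dynamics $\dot e_l=(A-LC)e_l$ and let $e_c$ be a solution of the cubic observer error dynamics $\dot e_c=(A-L_cC)e_c+(e_c^TC^T\theta Ce_c)N_cCe_c$, with Lyapunov functions $V_l(t)=e_l^T(t)Pe_l(t)$ and $V_c(t)=e_c^T(t)Pe_c(t)$. Then $$e_c^T(t)e_c(t)=e_l^T(t)e_l(t)\ \Longrightarrow\ \dot V_c(t)\le\dot V_l(t).$$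
   Context: The plant is $\dot x=Ax+Bu$, $y=Cx$. The linear observer is $\dot{\hat x}_l=(A-LC)\hat x_l+Bu+Ly$ with error $e_l=x-\hat x_l$; the cubic observer is $\dot{\hat x}_c=(A-L_cC)\hat x_c+L_cy+Bu-(e_c^TC^T\theta Ce_c)N_cCe_c$ with error $e_c=x-\hat x_c$. These errors satisfy the differential equations given in the claim. For symmetric matrices, $M<0$ means negative definite and $M\ge 0$ positive semidefinite. *)

theory Defs
  imports "HOL-Analysis.Analysis"
begin

text \<open>Definiteness is a property of symmetric matrices here; \<open>x \<bullet> (M *v x)\<close> is \<open>x\<^sup>T M x\<close>.\<close>

definition pos_def :: "real ^ 'n ^ 'n \<Rightarrow> bool" where
  "pos_def M \<longleftrightarrow> transpose M = M \<and> (\<forall>x. x \<noteq> 0 \<longrightarrow> x \<bullet> (M *v x) > 0)"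

definition pos_semidef :: "real ^ 'n ^ 'n \<Rightarrow> bool" where
  "pos_semidef M \<longleftrightarrow> transpose M = M \<and> (\<forall>x. x \<bullet> (M *v x) \<ge> 0)"

definition neg_def :: "real ^ 'n ^ 'n \<Rightarrow> bool" where
  "neg_def M \<longleftrightarrow> transpose M = M \<and> (\<forall>x. x \<noteq> 0 \<longrightarrow> x \<bullet> (M *v x) < 0)"

text \<open>Kalman's rank condition: the matrix obtained by stacking \<open>C, C A, \<dots>, C A\<^bsup>n - 1\<^esup>\<close> has
  rank \<open>n\<close>. Since \<open>n\<close> is the size of an index type, the stacked matrix is represented by the set
  of its rows. The power \<open>A ^ k\<close> would be entrywise, so \<open>C A\<^sup>k\<close> is obtained by iterating
  multiplication by \<open>A\<close> on the right.\<close>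

definition observable :: "real ^ 'n ^ 'n \<Rightarrow> real ^ 'n ^ 'p \<Rightarrow> bool" where
  "observable A C \<longleftrightarrow> dim (\<Union>k<CARD('n). rows (((\<lambda>M. M ** A) ^^ k) C)) = CARD('n)"

end

theory Submission
  imports Defs
begin

text \<open>Along a solution of \<open>x' = K x\<close> the quadratic function \<open>V = x\<^sup>T P x\<close> satisfies
  \<open>V' = x\<^sup>T (K\<^sup>T P + P K) x\<close>, and this remains true pointwise when \<open>K\<close> depends on the state.
  For the cubic observer the state-dependent matrix is \<open>K = (A - L\<^sub>c C) + q(x) N\<^sub>c C\<close> with
  \<open>q(x) = x\<^sup>T C\<^sup>T \<theta> C x\<close>. The Lyapunov equation with \<open>Q = \<rho> I\<close> turns the contribution of
  \<open>A - L\<^sub>c C\<close> into \<open>- \<rho> x\<^sup>T x\<close>, which depends on the norm of the error alone, so that errors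
  of equal norm give the linear and the cubic observer the same linear contribution. What
  distinguishes the two derivatives is the cubic contribution
  \<open>q(x) x\<^sup>T (P N\<^sub>c C + C\<^sup>T N\<^sub>c\<^sup>T P) x\<close>, the product of a nonnegative number (as \<open>\<theta> \<ge> 0\<close>) and
  a nonpositive one.

  The interval \<open>T\<close> has interior points, hence every point of \<open>T\<close>, endpoints included, is a
  limit point of \<open>T\<close>; this makes the derivative within \<open>T\<close> unique, so that the values
  computed by the product rule are the ones denoted by \<open>vector_derivative\<close>.\<close>

lemma has_vector_derivative_quadratic_form:
  fixes P :: "real ^ 'n ^ 'n"
  assumes "(e has_vector_derivative d) (at t within T)"
  shows "((\<lambda>s. e s \<bullet> (P *v e s)) has_vector_derivative
           d \<bullet> (P *v e t) + e t \<bullet> (P *v d)) (at t within T)"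
proof -
  have "((\<lambda>s. P *v e s) has_vector_derivative P *v d) (at t within T)"
    by (rule bounded_linear.has_vector_derivative[OF matrix_vector_mul_bounded_linear assms])
  from bounded_bilinear.has_vector_derivative[OF bounded_bilinear_inner assms this]
  show ?thesis by (simp add: add.commute)
qed

lemma inner_vector_matrix_mult:
  fixes M :: "real ^ 'n ^ 'm"
  shows "x \<bullet> (y v* M) = (M *v x) \<bullet> y"
  by (metis dot_lmul_matrix inner_commute)

lemma inner_Lyapunov_matrix:
  fixes K P :: "real ^ 'n ^ 'n"
  shows "x \<bullet> ((transpose K ** P + P ** K) *v x) = (K *v x) \<bullet> (P *v x) + x \<bullet> (P *v (K *v x))"
  by (simp add: matrix_vector_mult_add_rdistrib inner_add_right inner_vector_matrix_mult
      flip: matrix_vector_mul_assoc)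

text \<open>The general form \<open>K + q N\<close> of the right-hand side covers the linear error dynamics
  (\<open>q = 0\<close>) as well as the cubic ones, where \<open>q\<close> is the value of a quadratic form at the
  current error.\<close>

lemma has_vector_derivative_Lyapunov_function:
  fixes K N P :: "real ^ 'n ^ 'n"
  assumes "(e has_vector_derivative K *v e t + q *\<^sub>R (N *v e t)) (at t within T)"
  shows "((\<lambda>s. e s \<bullet> (P *v e s)) has_vector_derivative
           e t \<bullet> ((transpose K ** P + P ** K) *v e t)
             + q * (e t \<bullet> ((transpose N ** P + P ** N) *v e t))) (at t within T)"
  using has_vector_derivative_quadratic_form[OF assms, of P]
  unfolding inner_Lyapunov_matrix
  by (simp add: matrix_vector_right_distrib matrix_vector_mult_scaleR
      inner_add_left inner_add_right algebra_simps)

lemma inner_congruence_nonneg: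
  fixes \<theta> :: "real ^ 'p ^ 'p" and C :: "real ^ 'n ^ 'p"
  assumes "pos_semidef \<theta>"
  shows "0 \<le> x \<bullet> ((transpose C ** \<theta> ** C) *v x)"
proof -
  have "x \<bullet> ((transpose C ** \<theta> ** C) *v x) = (C *v x) \<bullet> (\<theta> *v (C *v x))"
    by (simp add: inner_vector_matrix_mult flip: matrix_vector_mul_assoc)
  with assms show ?thesis by (simp add: pos_semidef_def)
qed

lemma at_within_interval_neq_bot:
  fixes T :: "real set"
  assumes "is_interval T" and "interior T \<noteq> {}" and "t \<in> T"
  shows "at t within T \<noteq> bot"
proof -
  have "T \<noteq> {t}" using assms(2) by auto
  with assms have "t islimpt T"
    by (intro connected_imp_perfect) (auto simp: is_interval_connected)
  then show ?thesis by (simp add: trivial_limit_within)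
qed

theorem theorem3:
  fixes A P Q :: "real ^ 'n ^ 'n"
    and C :: "real ^ 'n ^ 'p"
    and L L\<^sub>c N\<^sub>c :: "real ^ 'p ^ 'n"
    and \<theta> :: "real ^ 'p ^ 'p"
    and \<rho> :: real
    and T :: "real set"
    and e\<^sub>l e\<^sub>c :: "real \<Rightarrow> real ^ 'n"
    and V\<^sub>l V\<^sub>c :: "real \<Rightarrow> real"
    and t :: real
  assumes "observable A C"
    and "L = L\<^sub>c"
    and "pos_semidef \<theta>"
    and "\<rho> > 0"
    and "pos_def P"
    and no_equilibrium: "\<not> (\<exists>v. v \<noteq> 0 \<and>
           (A - L\<^sub>c ** C) *v v
             + (v \<bullet> ((transpose C ** \<theta> ** C) *v v)) *\<^sub>R ((N\<^sub>c ** C) *v v) = 0)"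
    and lyapunov_eq: "transpose (A - L\<^sub>c ** C) ** P + P ** (A - L\<^sub>c ** C) = - Q"
    and "Q = \<rho> *\<^sub>R mat 1"
    and "neg_def (P ** N\<^sub>c ** C + transpose C ** transpose N\<^sub>c ** P)"
    and "is_interval T" and "interior T \<noteq> {}"
    and linear_error: "\<And>s. s \<in> T \<Longrightarrow>
           (e\<^sub>l has_vector_derivative (A - L ** C) *v e\<^sub>l s) (at s within T)"
    and cubic_error: "\<And>s. s \<in> T \<Longrightarrow>
           (e\<^sub>c has_vector_derivative
             (A - L\<^sub>c ** C) *v e\<^sub>c s
               + (e\<^sub>c s \<bullet> ((transpose C ** \<theta> ** C) *v e\<^sub>c s)) *\<^sub>R ((N\<^sub>c ** C) *v e\<^sub>c s))
           (at s within T)"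
    and "V\<^sub>l = (\<lambda>s. e\<^sub>l s \<bullet> (P *v e\<^sub>l s))"
    and "V\<^sub>c = (\<lambda>s. e\<^sub>c s \<bullet> (P *v e\<^sub>c s))"
    and "t \<in> T"
  shows "e\<^sub>c t \<bullet> e\<^sub>c t = e\<^sub>l t \<bullet> e\<^sub>l t \<longrightarrow>
           vector_derivative V\<^sub>c (at t within T) \<le> vector_derivative V\<^sub>l (at t within T)"
proof
  assume norm_eq: "e\<^sub>c t \<bullet> e\<^sub>c t = e\<^sub>l t \<bullet> e\<^sub>l t"
  let ?K = "A - L\<^sub>c ** C" and ?N = "N\<^sub>c ** C"
  let ?q = "e\<^sub>c t \<bullet> ((transpose C ** \<theta> ** C) *v e\<^sub>c t)"
  let ?M = "transpose ?N ** P + P ** ?N"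
  have nontrivial: "at t within T \<noteq> bot"
    using \<open>is_interval T\<close> \<open>interior T \<noteq> {}\<close> \<open>t \<in> T\<close> by (rule at_within_interval_neq_bot)
  have linear_part: "x \<bullet> ((transpose ?K ** P + P ** ?K) *v x) = - \<rho> * (x \<bullet> x)" for x
    unfolding lyapunov_eq \<open>Q = \<rho> *\<^sub>R mat 1\<close>
    by (simp flip: scaleR_minus_left scaleR_matrix_vector_assoc)

  have "(e\<^sub>l has_vector_derivative ?K *v e\<^sub>l t + 0 *\<^sub>R (?N *v e\<^sub>l t)) (at t within T)"
    using linear_error[OF \<open>t \<in> T\<close>] \<open>L = L\<^sub>c\<close> by simp
  from has_vector_derivative_Lyapunov_function[OF this, of P]
  have "(V\<^sub>l has_vector_derivative - \<rho> * (e\<^sub>l t \<bullet> e\<^sub>l t)) (at t within T)"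
    unfolding \<open>V\<^sub>l = _\<close> linear_part by simp
  then have V\<^sub>l': "vector_derivative V\<^sub>l (at t within T) = - \<rho> * (e\<^sub>l t \<bullet> e\<^sub>l t)"
    by (rule vector_derivative_within[OF nontrivial])

  from has_vector_derivative_Lyapunov_function[OF cubic_error[OF \<open>t \<in> T\<close>], of P]
  have "(V\<^sub>c has_vector_derivative - \<rho> * (e\<^sub>c t \<bullet> e\<^sub>c t) + ?q * (e\<^sub>c t \<bullet> (?M *v e\<^sub>c t)))
          (at t within T)"
    unfolding \<open>V\<^sub>c = _\<close> linear_part .
  then have V\<^sub>c': "vector_derivative V\<^sub>c (at t within T)
      = - \<rho> * (e\<^sub>c t \<bullet> e\<^sub>c t) + ?q * (e\<^sub>c t \<bullet> (?M *v e\<^sub>c t))"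
    by (rule vector_derivative_within[OF nontrivial])

  have "?M = P ** N\<^sub>c ** C + transpose C ** transpose N\<^sub>c ** P"
    by (simp add: matrix_transpose_mul matrix_mul_assoc add.commute)
  with \<open>neg_def _\<close> have "e\<^sub>c t \<bullet> (?M *v e\<^sub>c t) \<le> 0"
    unfolding neg_def_def by (cases "e\<^sub>c t = 0") (auto intro: less_imp_le)
  then have "?q * (e\<^sub>c t \<bullet> (?M *v e\<^sub>c t)) \<le> 0"
    by (intro mult_nonneg_nonpos inner_congruence_nonneg \<open>pos_semidef \<theta>\<close>)
  then show "vector_derivative V\<^sub>c (at t within T) \<le> vector_derivative V\<^sub>l (at t within T)"
    using norm_eq by (simp add: V\<^sub>l' V\<^sub>c')
qed

end
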